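(* Let $M$ be a nonnegative real $N\times N$ matrix defining a strongly connected graph. Let $\lambda>0$, $\psi$, $\varphi$ be its dominant positive eigenvalue and positive right and left eigenvectors, $M\psi=\lambda\psi$, $\varphi^TM=\lambda\varphi^T$, normalized so that $\sum_i\varphi_i\psi_i=1$. For $l\ge 1$ let $$S^{\mathrm{GRW}_l(M)}_{ij}:=\frac{M_{ij}\sum_k (M^{l-1})_{jk}}{\sum_{j'}M_{ij'}\sum_k (M^{l-1})_{j'k}}.$$ Then for all $i,j$ the limit $S^{\mathrm{M}}_{ij}:=\lim_{l\to\infty}S^{\mathrm{GRW}_l(M)}_{ij}$ exists and equals $$S^{\mathrm{M}}_{ij}=\frac{M_{ij}}{\lambda}\frac{\psi_j}{\psi_i},$$ and the stationary probability density $\pi^{\mathrm{M}}$ of the stochastic matrix $S^{\mathrm{M}}$ is $$\pi^{\mathrm{M}}_i=\varphi_i\psi_i$$ (which equals $\psi_i^2$, with $\varphi=\psi$, when $M$ is symmetric).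
   Context: A (weighted, possibly directed) graph on vertices $\{1,\dots,N\}$ is identified with a nonnegative real $N\times N$ matrix $M$; there is an edge from $i$ to $j$ iff $M_{ij}>0$ (self-loops allowed). The graph is strongly connected if for all $i,j$ there is $l\ge 1$ with $(M^l)_{ij}>0$; it is allowed to be periodic. For a strongly connected graph, the dominant positive eigenvalue $\lambda$ is the unique real positive eigenvalue of maximal absolute value (the spectral radius); it has right and left eigenvectors $\psi,\varphi$ with all coordinates strictly positive, unique up to scaling (Perron-Frobenius). A matrix $S$ is stochastic on the graph $M$ if $0\le S_{ij}\le 1$, $\sum_jS_{ij}=1$ for all $i$, and $M_{ij}=0\Rightarrow S_{ij}=0$. A stationary probability density of $S$ is a nonnegative vector $\pi$ with $\sum_i\pi_i=1$ and $\sum_i\pi_iS_{ij}=\pi_j$ for all $j$. $M^0$ is the identity matrix. *)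

theory Defs
  imports "Jordan_Normal_Form.Spectral_Radius"
begin

text \<open>Graphs are real square matrices; the vertices 1, ..., N become the indices 0, ..., N - 1.\<close>

definition nonneg_matrix :: "real mat \<Rightarrow> bool" where
  "nonneg_matrix M \<longleftrightarrow> (\<forall>i<dim_row M. \<forall>j<dim_col M. 0 \<le> M $$ (i, j))"

definition strongly_connected :: "real mat \<Rightarrow> bool" where
  "strongly_connected M \<longleftrightarrow>
     (\<forall>i<dim_row M. \<forall>j<dim_row M. \<exists>l\<ge>1. 0 < (M ^\<^sub>m l) $$ (i, j))"

text \<open>Maximality is over all complex eigenvalues; other eigenvalues of the same modulus are allowed,
  as they occur for periodic graphs.\<close>

definition dominant_eigenvalue :: "real mat \<Rightarrow> real \<Rightarrow> bool" where
  "dominant_eigenvalue M lam \<longleftrightarrow>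
     0 < lam \<and> eigenvalue M lam \<and> spectral_radius (map_mat complex_of_real M) = lam"

definition positive_vector :: "real vec \<Rightarrow> bool" where
  "positive_vector v \<longleftrightarrow> (\<forall>i<dim_vec v. 0 < v $ i)"

text \<open>The left eigenvector \<open>\<phi>\<close> is rendered as an eigenvector of the transpose.\<close>

definition perron_data :: "real mat \<Rightarrow> real \<Rightarrow> real vec \<Rightarrow> real vec \<Rightarrow> bool" where
  "perron_data M lam \<psi> \<phi> \<longleftrightarrow>
     dominant_eigenvalue M lam \<and>
     eigenvector M \<psi> lam \<and> positive_vector \<psi> \<and>
     eigenvector (transpose_mat M) \<phi> lam \<and> positive_vector \<phi> \<and>
     (\<Sum>i<dim_row M. \<phi> $ i * \<psi> $ i) = 1"

definition stochastic_on :: "real mat \<Rightarrow> real mat \<Rightarrow> bool" where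
  "stochastic_on M S \<longleftrightarrow>
     S \<in> carrier_mat (dim_row M) (dim_col M) \<and>
     (\<forall>i<dim_row M. \<forall>j<dim_col M. 0 \<le> S $$ (i, j) \<and> S $$ (i, j) \<le> 1) \<and>
     (\<forall>i<dim_row M. (\<Sum>j<dim_col M. S $$ (i, j)) = 1) \<and>
     (\<forall>i<dim_row M. \<forall>j<dim_col M. M $$ (i, j) = 0 \<longrightarrow> S $$ (i, j) = 0)"

definition stationary_density :: "real mat \<Rightarrow> real vec \<Rightarrow> bool" where
  "stationary_density S p \<longleftrightarrow>
     p \<in> carrier_vec (dim_row S) \<and>
     (\<forall>i<dim_row S. 0 \<le> p $ i) \<and>
     (\<Sum>i<dim_row S. p $ i) = 1 \<and>
     (\<forall>j<dim_col S. (\<Sum>i<dim_row S. p $ i * S $$ (i, j)) = p $ j)"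

definition path_weight :: "real mat \<Rightarrow> nat \<Rightarrow> nat \<Rightarrow> real" where
  "path_weight M l j = (\<Sum>k<dim_row M. (M ^\<^sub>m l) $$ (j, k))"

text \<open>The generic random walk of order \<open>l\<close> is meant for \<open>l \<ge> 1\<close>; at \<open>l = 0\<close> the truncated
  subtraction repeats the case \<open>l = 1\<close>, which does not affect the limit.\<close>

definition grw_mat :: "nat \<Rightarrow> real mat \<Rightarrow> real mat" where
  "grw_mat l M = mat (dim_row M) (dim_row M) (\<lambda>(i, j).
     M $$ (i, j) * path_weight M (l - 1) j /
       (\<Sum>j'<dim_row M. M $$ (i, j') * path_weight M (l - 1) j'))"

text \<open>\<^const>\<open>lim\<close> is only meaningful where the entrywise limits
  exist.\<close>

definition merw_mat :: "real mat \<Rightarrow> real mat" where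
  "merw_mat M = mat (dim_row M) (dim_row M) (\<lambda>(i, j). lim (\<lambda>l. grw_mat l M $$ (i, j)))"

end

theory Submission
  imports Defs
begin

text \<open>Conjugating \<open>M / \<lambda>\<close> by the diagonal matrix of \<open>\<psi>\<close> gives a stochastic matrix \<open>P\<close> with stationary
  density \<open>\<pi> i = \<phi> i * \<psi> i\<close>, and \<open>h l i = path_weight M l i / (\<lambda> ^ l * \<psi> i)\<close> satisfies
  \<open>h (l + 1) = P h l\<close>. The order-\<open>l + 1\<close> random walk is \<open>P i j * h l j / h (l + 1) i\<close>. The energies
  \<open>\<Sum>i. \<pi> i * (h l i)\<^sup>2\<close> decrease, and by the variance identity their decrements are
  \<open>\<Sum>i j. \<pi> i * P i j * (h l j - h (l + 1) i)\<^sup>2\<close>; these tend to 0, so \<open>h l j - h (l + 1) i\<close> tends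
  to 0 along every edge. As \<open>h\<close> is bounded below, the quotient tends to 1. Aperiodicity is
  never needed, because only pairs \<open>(l, j)\<close>, \<open>(l + 1, i)\<close> joined by an edge are compared.\<close>

section \<open>Energy decay under averaging\<close>

text \<open>Since row \<open>i\<close> of \<open>P\<close> has total mass 1 and \<open>g i\<close>
  is the mean of \<open>f\<close> under it, the inner sum is \<open>w i\<close> times second moment
  minus squared mean. Stationarity of \<open>w\<close> then turns the averaged second moments into
  the energy of \<open>f\<close>.\<close>

lemma variance_identity:
  fixes P :: "'a \<Rightarrow> 'a \<Rightarrow> real" and w f g :: "'a \<Rightarrow> real"
  assumes row: "\<And>i. i \<in> A \<Longrightarrow> (\<Sum>j\<in>A. P i j) = 1"
    and stat: "\<And>j. j \<in> A \<Longrightarrow> (\<Sum>i\<in>A. w i * P i j) = w j"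
    and g: "\<And>i. i \<in> A \<Longrightarrow> g i = (\<Sum>j\<in>A. P i j * f j)"
  shows "(\<Sum>i\<in>A. \<Sum>j\<in>A. w i * P i j * (f j - g i)\<^sup>2) = (\<Sum>i\<in>A. w i * (f i)\<^sup>2) - (\<Sum>i\<in>A. w i * (g i)\<^sup>2)"
proof -
  have inner: "(\<Sum>j\<in>A. w i * P i j * (f j - g i)\<^sup>2) = (\<Sum>j\<in>A. w i * P i j * (f j)\<^sup>2) - w i * (g i)\<^sup>2"
    if "i \<in> A" for i
  proof -
    have "(\<Sum>j\<in>A. w i * P i j * (f j - g i)\<^sup>2)
        = (\<Sum>j\<in>A. w i * P i j * (f j)\<^sup>2 - 2 * w i * g i * (P i j * f j) + w i * (g i)\<^sup>2 * P i j)"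
      by (intro sum.cong) (auto simp: power2_eq_square algebra_simps)
    also have "\<dots> = (\<Sum>j\<in>A. w i * P i j * (f j)\<^sup>2) - 2 * w i * g i * (\<Sum>j\<in>A. P i j * f j)
        + w i * (g i)\<^sup>2 * (\<Sum>j\<in>A. P i j)"
      by (simp add: sum.distrib sum_subtractf sum_distrib_left)
    also have "\<dots> = (\<Sum>j\<in>A. w i * P i j * (f j)\<^sup>2) - w i * (g i)\<^sup>2"
      using that by (simp add: row g[symmetric] power2_eq_square)
    finally show ?thesis .
  qed
  have "(\<Sum>i\<in>A. \<Sum>j\<in>A. w i * P i j * (f j)\<^sup>2) = (\<Sum>j\<in>A. \<Sum>i\<in>A. w i * P i j * (f j)\<^sup>2)"
    by (rule sum.swap)
  also have "\<dots> = (\<Sum>j\<in>A. w j * (f j)\<^sup>2)"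
    by (intro sum.cong) (simp_all add: stat flip: sum_distrib_right)
  finally show ?thesis
    by (simp add: inner sum_subtractf)
qed

text \<open>The energies converge because they decrease and are nonnegative, so their decrements
  tend to 0 whatever the limit is. Each decrement is a sum of nonnegative terms and dominates the
  term of the pair \<open>(a, b)\<close>, whose weight \<open>w a * P a b\<close> is a positive
  constant and can be divided out.\<close>

lemma averaging_gap_tendsto_0:
  fixes P :: "'a \<Rightarrow> 'a \<Rightarrow> real" and w :: "'a \<Rightarrow> real" and h :: "nat \<Rightarrow> 'a \<Rightarrow> real"
  assumes fin: "finite A"
    and nonneg: "\<And>i j. i \<in> A \<Longrightarrow> j \<in> A \<Longrightarrow> 0 \<le> P i j"
    and row: "\<And>i. i \<in> A \<Longrightarrow> (\<Sum>j\<in>A. P i j) = 1"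
    and w: "\<And>i. i \<in> A \<Longrightarrow> 0 \<le> w i"
    and stat: "\<And>j. j \<in> A \<Longrightarrow> (\<Sum>i\<in>A. w i * P i j) = w j"
    and h: "\<And>l i. i \<in> A \<Longrightarrow> h (Suc l) i = (\<Sum>j\<in>A. P i j * h l j)"
    and a: "a \<in> A" and b: "b \<in> A" and pos: "0 < w a" "0 < P a b"
  shows "(\<lambda>l. h l b - h (Suc l) a) \<longlonglongrightarrow> 0"
proof -
  define E where "E l = (\<Sum>i\<in>A. w i * (h l i)\<^sup>2)" for l
  define D where "D l = (\<Sum>i\<in>A. \<Sum>j\<in>A. w i * P i j * (h l j - h (Suc l) i)\<^sup>2)" for l
  have D: "D l = E l - E (Suc l)" for l
    unfolding D_def E_def using row stat h by (rule variance_identity)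
  have D_ge: "w a * P a b * (h l b - h (Suc l) a)\<^sup>2 \<le> D l" for l
  proof -
    have "w a * P a b * (h l b - h (Suc l) a)\<^sup>2 \<le> (\<Sum>j\<in>A. w a * P a j * (h l j - h (Suc l) a)\<^sup>2)"
      using a b fin nonneg w
      by (intro member_le_sum[where f = "\<lambda>j. w a * P a j * (h l j - h (Suc l) a)\<^sup>2"]) auto
    also have "\<dots> \<le> D l"
      unfolding D_def using a fin nonneg w
      by (intro member_le_sum[where f = "\<lambda>i. \<Sum>j\<in>A. w i * P i j * (h l j - h (Suc l) i)\<^sup>2"])
        (auto intro!: sum_nonneg)
    finally show ?thesis .
  qed
  have "0 \<le> D l" for l
    by (rule order_trans[OF _ D_ge]) (use pos in auto)
  then have "decseq E"
    by (intro decseq_SucI) (simp add: D)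
  moreover have "0 \<le> E l" for l
    unfolding E_def using w by (auto intro!: sum_nonneg)
  ultimately obtain e where "E \<longlonglongrightarrow> e"
    by (metis decseq_convergent)
  then have "D \<longlonglongrightarrow> e - e"
    unfolding D by (intro tendsto_diff LIMSEQ_Suc)
  then have "D \<longlonglongrightarrow> 0"
    by simp
  moreover have "norm ((h l b - h (Suc l) a)\<^sup>2) \<le> norm (D l) * (1 / (w a * P a b))" for l
    using order_trans[OF D_ge abs_ge_self, of l] pos by (simp add: field_simps)
  ultimately have "(\<lambda>l. (h l b - h (Suc l) a)\<^sup>2) \<longlonglongrightarrow> 0"
    by (rule tendsto_0_le[OF _ always_eventually[OF allI]])
  then have "(\<lambda>l. sqrt ((h l b - h (Suc l) a)\<^sup>2)) \<longlonglongrightarrow> sqrt 0"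
    by (rule tendsto_real_sqrt)
  then show ?thesis
    by (simp add: tendsto_rabs_zero_iff)
qed

section \<open>Eigenvector equations and path weights as finite sums\<close>

lemma index_mult_mat_sum:
  assumes "A \<in> carrier_mat n n" "B \<in> carrier_mat n n" "i < n" "j < n"
  shows "(A * B) $$ (i, j) = (\<Sum>k<n. A $$ (i, k) * B $$ (k, j))"
  using assms by (auto simp: scalar_prod_def lessThan_atLeast0 intro!: sum.cong)

lemma eigenvector_sum:
  assumes "A \<in> carrier_mat n n" "eigenvector A v k" "i < n"
  shows "(\<Sum>j<n. A $$ (i, j) * v $ j) = k * v $ i"
proof -
  have v: "v \<in> carrier_vec n" and eq: "A *\<^sub>v v = k \<cdot>\<^sub>v v"
    using assms by (auto simp: eigenvector_def)
  have "(A *\<^sub>v v) $ i = (\<Sum>j<n. A $$ (i, j) * v $ j)"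
    using assms v by (auto simp: scalar_prod_def lessThan_atLeast0 intro!: sum.cong)
  then show ?thesis
    using assms v by (simp add: eq)
qed

lemma left_eigenvector_sum:
  assumes "A \<in> carrier_mat n n" "eigenvector (transpose_mat A) v k" "j < n"
  shows "(\<Sum>i<n. v $ i * A $$ (i, j)) = k * v $ j"
proof -
  have "(\<Sum>i<n. transpose_mat A $$ (j, i) * v $ i) = k * v $ j"
    using assms by (intro eigenvector_sum) auto
  then show ?thesis
    using assms by (simp add: mult.commute)
qed

lemma eigenvector_smult:
  fixes A :: "'a :: field mat"
  assumes "A \<in> carrier_mat n n" "eigenvector A v k" "c \<noteq> 0"
  shows "eigenvector A (c \<cdot>\<^sub>v v) k"
proof -
  have v: "v \<in> carrier_vec n" "v \<noteq> 0\<^sub>v n" and eq: "A *\<^sub>v v = k \<cdot>\<^sub>v v"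
    using assms by (auto simp: eigenvector_def)
  have "c \<cdot>\<^sub>v v \<noteq> 0\<^sub>v n"
  proof
    assume z: "c \<cdot>\<^sub>v v = 0\<^sub>v n"
    have "v $ i = 0" if "i < n" for i
      using arg_cong[OF z, of "\<lambda>u. u $ i"] that v assms(3) by simp
    with v show False
      by (auto simp: vec_eq_iff)
  qed
  then show ?thesis
    using assms v eq
    by (auto simp: eigenvector_def mult_mat_vec smult_smult_assoc mult.commute)
qed

text \<open>The recursion of \<open>pow_mat\<close> appends the new factor on the right; splitting
  off the first edge of a walk needs it on the left.\<close>

lemma pow_mat_Suc_left:
  assumes "A \<in> carrier_mat n n"
  shows "A ^\<^sub>m Suc l = A * A ^\<^sub>m l"
proof (induction l)
  case (Suc l)
  have "A ^\<^sub>m Suc (Suc l) = (A * A ^\<^sub>m l) * A"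
    by (simp flip: Suc)
  then show ?case
    using assms by (simp add: assoc_mult_mat[of A n n "A ^\<^sub>m l" n A n])
qed (use assms in simp)

text \<open>Besides giving the recursion for \<open>h\<close>, this identifies the denominator of
  the random walk of order \<open>l + 1\<close> as \<open>path_weight M (Suc l) i\<close>.\<close>

lemma path_weight_Suc:
  assumes "M \<in> carrier_mat N N" "i < N"
  shows "path_weight M (Suc l) i = (\<Sum>j<N. M $$ (i, j) * path_weight M l j)"
proof -
  have "path_weight M (Suc l) i = (\<Sum>k<N. \<Sum>j<N. M $$ (i, j) * (M ^\<^sub>m l) $$ (j, k))"
    using assms unfolding path_weight_def pow_mat_Suc_left[OF assms(1)]
    by (auto simp del: pow_mat.simps index_mult_mat simp: index_mult_mat_sum[of _ N] intro!: sum.cong)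
  also have "\<dots> = (\<Sum>j<N. \<Sum>k<N. M $$ (i, j) * (M ^\<^sub>m l) $$ (j, k))"
    by (rule sum.swap)
  finally show ?thesis
    using assms by (simp add: path_weight_def sum_distrib_left)
qed

section \<open>Uniqueness of positive left eigenfunctions up to scaling\<close>

lemma pow_mat_nonneg:
  assumes "M \<in> carrier_mat N N" "nonneg_matrix M" "i < N" "j < N"
  shows "0 \<le> (M ^\<^sub>m l) $$ (i, j)"
  using assms(3,4)
proof (induction l arbitrary: i j)
  case (Suc l)
  then have "(M ^\<^sub>m Suc l) $$ (i, j) = (\<Sum>k<N. (M ^\<^sub>m l) $$ (i, k) * M $$ (k, j))"
    using assms(1) by (simp add: index_mult_mat_sum[of _ N] del: index_mult_mat)
  then show ?case
    using Suc assms(1,2) by (auto simp: nonneg_matrix_def intro!: sum_nonneg)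
qed (use assms in simp)

text \<open>Stated for functions instead of \<open>eigenvector\<close>, which excludes zero: the
  uniqueness argument applies it to a difference that turns out to vanish.\<close>

lemma left_eigenfunction_pow:
  fixes M :: "real mat"
  assumes M: "M \<in> carrier_mat N N"
    and w: "\<And>j. j < N \<Longrightarrow> (\<Sum>i<N. w i * M $$ (i, j)) = lam * w j"
    and j: "j < N"
  shows "(\<Sum>i<N. w i * (M ^\<^sub>m l) $$ (i, j)) = lam ^ l * w j"
  using j
proof (induction l arbitrary: j)
  case 0
  have "(\<Sum>i<N. w i * (M ^\<^sub>m 0) $$ (i, j)) = (\<Sum>i<N. if i = j then w i else 0)"
    using 0 M by (intro sum.cong) auto
  then show ?case
    using 0 by simp
next
  case (Suc l)
  then have "(\<Sum>i<N. w i * (M ^\<^sub>m Suc l) $$ (i, j))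
      = (\<Sum>i<N. \<Sum>k<N. w i * ((M ^\<^sub>m l) $$ (i, k) * M $$ (k, j)))"
    using M by (simp add: index_mult_mat_sum[of _ N] sum_distrib_left del: index_mult_mat)
  also have "\<dots> = (\<Sum>k<N. (\<Sum>i<N. w i * (M ^\<^sub>m l) $$ (i, k)) * M $$ (k, j))"
    by (subst sum.swap) (simp add: sum_distrib_right mult.assoc)
  also have "\<dots> = (\<Sum>k<N. lam ^ l * (w k * M $$ (k, j)))"
    using Suc.IH by (intro sum.cong) auto
  also have "\<dots> = lam ^ Suc l * w j"
    using w[OF Suc.prems] by (simp flip: sum_distrib_left)
  finally show ?case .
qed

text \<open>A zero spreads backwards along walks: choose \<open>l\<close> with a walk from
  \<open>i\<close> to \<open>k\<close>. Coordinate \<open>k\<close> of the eigenequation for the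
  \<open>l\<close>-th power is a vanishing sum of nonnegative terms, and in term \<open>i\<close>
  the matrix entry is positive.\<close>

lemma nonneg_left_eigenfunction_eq_0:
  assumes M: "M \<in> carrier_mat N N" "nonneg_matrix M" "strongly_connected M"
    and w: "\<And>j. j < N \<Longrightarrow> (\<Sum>i<N. w i * M $$ (i, j)) = lam * w j"
    and nonneg: "\<And>i. i < N \<Longrightarrow> 0 \<le> w i"
    and k: "k < N" "w k = 0" and i: "i < N"
  shows "w i = 0"
proof -
  obtain l where l: "0 < (M ^\<^sub>m l) $$ (i, k)"
    using M i k by (auto simp: strongly_connected_def)
  have "w i * (M ^\<^sub>m l) $$ (i, k) \<le> (\<Sum>i<N. w i * (M ^\<^sub>m l) $$ (i, k))"
    using i k nonneg pow_mat_nonneg[OF M(1,2)]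
    by (intro member_le_sum[where f = "\<lambda>i. w i * (M ^\<^sub>m l) $$ (i, k)"]) auto
  also have "\<dots> = 0"
    using left_eigenfunction_pow[OF M(1) w k(1), of l] k by simp
  finally show ?thesis
    using l nonneg[OF i] by (simp add: mult_le_0_iff)
qed

text \<open>Subtract from \<open>w\<close> the largest multiple of \<open>v\<close> that leaves a
  nonnegative remainder. The remainder is again a left eigenfunction and vanishes where the ratio
  \<open>w i / v i\<close> is minimal, hence everywhere. This serves both the uniqueness of the
  stationary density and the symmetric case.\<close>

lemma left_eigenfunction_unique:
  assumes M: "M \<in> carrier_mat N N" "nonneg_matrix M" "strongly_connected M"
    and v: "\<And>j. j < N \<Longrightarrow> (\<Sum>i<N. v i * M $$ (i, j)) = lam * v j"
    and pos: "\<And>i. i < N \<Longrightarrow> 0 < v i"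
    and w: "\<And>j. j < N \<Longrightarrow> (\<Sum>i<N. w i * M $$ (i, j)) = lam * w j"
  shows "\<exists>c. \<forall>i<N. w i = c * v i"
proof (cases "N = 0")
  case False
  define c where "c = Min ((\<lambda>i. w i / v i) ` {..<N})"
  have "c \<in> (\<lambda>i. w i / v i) ` {..<N}"
    unfolding c_def using False by (intro Min_in) auto
  then obtain k where k: "k < N" "c = w k / v k"
    by auto
  define u where "u i = w i - c * v i" for i
  have "u i = 0" if "i < N" for i
  proof (rule nonneg_left_eigenfunction_eq_0[OF M, of u lam k])
    fix j assume j: "j < N"
    have "(\<Sum>i<N. u i * M $$ (i, j)) = (\<Sum>i<N. w i * M $$ (i, j)) - c * (\<Sum>i<N. v i * M $$ (i, j))"
      by (simp add: u_def algebra_simps sum_subtractf sum_distrib_left)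
    also have "\<dots> = lam * u j"
      by (simp add: u_def v w j algebra_simps)
    finally show "(\<Sum>i<N. u i * M $$ (i, j)) = lam * u j" .
    have "c \<le> w j / v j"
      unfolding c_def using j by (intro Min_le) auto
    then show "0 \<le> u j"
      using pos[OF j] by (simp add: u_def field_simps)
  qed (use k pos[of k] that in \<open>auto simp: u_def\<close>)
  then show ?thesis
    by (auto simp: u_def)
qed simp

section \<open>The limit walk and its stationary density\<close>

theorem mainTheorem2:
  fixes M :: "real mat" and N :: nat and lam :: real and \<psi> \<phi> :: "real vec"
  assumes "M \<in> carrier_mat N N"
    and "nonneg_matrix M"
    and "strongly_connected M"
    and "perron_data M lam \<psi> \<phi>"
  shows "(\<forall>i<N. \<forall>j<N. convergent (\<lambda>l. grw_mat l M $$ (i, j))) \<and>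
         (\<forall>i<N. \<forall>j<N. merw_mat M $$ (i, j) = M $$ (i, j) / lam * (\<psi> $ j / \<psi> $ i)) \<and>
         stochastic_on M (merw_mat M) \<and>
         (\<forall>p. stationary_density (merw_mat M) p \<longleftrightarrow> p = vec N (\<lambda>i. \<phi> $ i * \<psi> $ i)) \<and>
         (transpose_mat M = M \<longrightarrow>
            (\<exists>c>0. perron_data M lam (c \<cdot>\<^sub>v \<psi>) (c \<cdot>\<^sub>v \<psi>) \<and>
                   vec N (\<lambda>i. \<phi> $ i * \<psi> $ i) = vec N (\<lambda>i. ((c \<cdot>\<^sub>v \<psi>) $ i)\<^sup>2)) \<and>
            ((\<Sum>i<N. (\<psi> $ i)\<^sup>2) = 1 \<longrightarrow>
               \<phi> = \<psi> \<and> vec N (\<lambda>i. \<phi> $ i * \<psi> $ i) = vec N (\<lambda>i. (\<psi> $ i)\<^sup>2)))"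
proof -
  let ?P = "\<lambda>i j. M $$ (i, j) / lam * (\<psi> $ j / \<psi> $ i)"
  let ?pi = "\<lambda>i. \<phi> $ i * \<psi> $ i"
  note M = assms(1-3)
  have dim: "dim_row M = N" "dim_col M = N"
    using M by auto
  have lam: "0 < lam" and right: "eigenvector M \<psi> lam"
    and left: "eigenvector (transpose_mat M) \<phi> lam" and norm: "(\<Sum>i<N. ?pi i) = 1"
    and dom: "dominant_eigenvalue M lam"
    and pos': "positive_vector \<psi>" "positive_vector \<phi>"
    using assms(4) dim by (auto simp: perron_data_def dominant_eigenvalue_def)
  have carrier: "\<psi> \<in> carrier_vec N" "\<phi> \<in> carrier_vec N"
    using right left dim by (auto simp: eigenvector_def)
  have pos: "0 < \<psi> $ i" "0 < \<phi> $ i" if "i < N" for i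
    using pos' that carrier by (auto simp: positive_vector_def)
  \<comment> \<open>An empty sum could not equal 1. A vertex is needed for the minimum defining
    \<open>m\<close> and for the sign of \<open>d\<close>.\<close>
  have "N \<noteq> 0"
    using norm by (cases "N = 0") auto
  have M_nonneg: "0 \<le> M $$ (i, j)" if "i < N" "j < N" for i j
    using M that by (auto simp: nonneg_matrix_def)
  note right_sum = eigenvector_sum[OF M(1) right]
  note left_sum = left_eigenvector_sum[OF M(1) left]

  have P_nonneg: "0 \<le> ?P i j" if "i < N" "j < N" for i j
    using that lam M_nonneg pos[of i] pos[of j] by simp
  have P_row: "(\<Sum>j<N. ?P i j) = 1" if i: "i < N" for i
  proof -
    have "(\<Sum>j<N. ?P i j) = (\<Sum>j<N. M $$ (i, j) * \<psi> $ j) / (lam * \<psi> $ i)"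
      by (simp add: sum_divide_distrib)
    then show ?thesis
      using right_sum[OF i] lam pos[OF i] by simp
  qed
  \<comment> \<open>Dividing by \<open>\<psi>\<close> undoes the conjugation, so stationary vectors
    of \<open>?P\<close> correspond to left eigenfunctions of \<open>M\<close>. One direction gives
    stationarity of \<open>?pi\<close>, the other its uniqueness.\<close>
  have stat_iff: "(\<Sum>i<N. p i * ?P i j) = p j
      \<longleftrightarrow> (\<Sum>i<N. p i / \<psi> $ i * M $$ (i, j)) = lam * (p j / \<psi> $ j)" if j: "j < N" for p j
  proof -
    have "(\<Sum>i<N. p i * ?P i j) = \<psi> $ j / lam * (\<Sum>i<N. p i / \<psi> $ i * M $$ (i, j))"
      unfolding sum_distrib_left by (intro sum.cong) (auto simp: field_simps)
    then show ?thesis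
      using lam pos[OF j] by (auto simp: field_simps)
  qed
  have P_stat: "(\<Sum>i<N. ?pi i * ?P i j) = ?pi j" if j: "j < N" for j
  proof -
    have "(\<Sum>i<N. ?pi i / \<psi> $ i * M $$ (i, j)) = (\<Sum>i<N. \<phi> $ i * M $$ (i, j))"
      using pos by (intro sum.cong refl) (metis less_irrefl lessThan_iff nonzero_mult_div_cancel_right)
    then show ?thesis
      using left_sum[OF j] pos(1)[OF j] by (subst stat_iff[OF j]) simp
  qed

  \<comment> \<open>Normalized path weights\<close>
  define h where "h l i = path_weight M l i / (lam ^ l * \<psi> $ i)" for l i
  have pw: "path_weight M l i = h l i * lam ^ l * \<psi> $ i" if "i < N" for l i
    using lam pos(1)[OF that] by (simp add: h_def)
  have h_Suc: "h (Suc l) i = (\<Sum>j<N. ?P i j * h l j)" if i: "i < N" for l i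
  proof -
    have "h (Suc l) i = (\<Sum>j<N. M $$ (i, j) * (h l j * lam ^ l * \<psi> $ j)) / (lam ^ Suc l * \<psi> $ i)"
      using M(1) i by (simp add: h_def[of "Suc l"] path_weight_Suc pw)
    also have "\<dots> = (\<Sum>j<N. ?P i j * h l j)"
      unfolding sum_divide_distrib using lam by (intro sum.cong) (auto simp: field_simps)
    finally show ?thesis .
  qed
  \<comment> \<open>The bound is the minimum of \<open>h 0 i = 1 / \<psi> $ i\<close>; averaging
    with the rows of \<open>?P\<close> never goes below it, so it is uniform in
    \<open>l\<close>.\<close>
  obtain m where m: "0 < m" "\<And>l i. i < N \<Longrightarrow> m \<le> h l i"
  proof
    define m where "m = Min ((\<lambda>i. 1 / \<psi> $ i) ` {..<N})"
    show "0 < m"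
      unfolding m_def using \<open>N \<noteq> 0\<close> pos by (subst Min_gr_iff) auto
    show "m \<le> h l i" if "i < N" for l i
      using that
    proof (induction l arbitrary: i)
      case 0
      have "path_weight M 0 i = (\<Sum>k<N. if k = i then 1 else 0)"
        unfolding path_weight_def dim using 0 M(1) by (intro sum.cong) auto
      then have "h 0 i = 1 / \<psi> $ i"
        using 0 by (simp add: h_def)
      then show ?case
        unfolding m_def using 0 by (auto intro!: Min_le)
    next
      case (Suc l)
      have "m = (\<Sum>j<N. ?P i j * m)"
        unfolding sum_distrib_right[symmetric] P_row[OF Suc.prems] by simp
      also have "\<dots> \<le> h (Suc l) i"
        unfolding h_Suc[OF Suc.prems] using Suc P_nonneg
        by (intro sum_mono mult_left_mono) auto
      finally show ?case .
    qed
  qed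

  \<comment> \<open>Convergence of the generic random walks\<close>
  have grw: "grw_mat (Suc l) M $$ (i, j) = ?P i j * (h l j / h (Suc l) i)" if "i < N" "j < N" for l i j
  proof -
    have "grw_mat (Suc l) M $$ (i, j) = M $$ (i, j) * path_weight M l j / path_weight M (Suc l) i"
      using that M(1) by (simp add: grw_mat_def path_weight_Suc)
    then show ?thesis
      using that lam pos(1)[of i] by (simp add: pw mult_ac)
  qed
  have limit: "(\<lambda>l. grw_mat l M $$ (i, j)) \<longlonglongrightarrow> ?P i j" if ij: "i < N" "j < N" for i j
  proof -
    have "(\<lambda>l. ?P i j * (h l j / h (Suc l) i)) \<longlonglongrightarrow> ?P i j"
    proof (cases "M $$ (i, j) = 0")
      case False
      then have P_pos: "0 < ?P i j"
        using M_nonneg[OF ij] lam pos(1)[OF ij(1)] pos(1)[OF ij(2)] by simp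
      have gap: "(\<lambda>l. h l j - h (Suc l) i) \<longlonglongrightarrow> 0"
        by (rule averaging_gap_tendsto_0[of "{..<N}" ?P ?pi])
          (use ij P_nonneg P_row P_stat h_Suc P_pos pos in \<open>auto intro: less_imp_le\<close>)
      have h_pos: "0 < h l i" for l
        using m(1) m(2)[OF ij(1)] by (rule less_le_trans)
      \<comment> \<open>The relative gap is at most the gap divided by \<open>m\<close>; adding 1 to
        it gives the quotient \<open>h l j / h (Suc l) i\<close>.\<close>
      have "(\<lambda>l. (h l j - h (Suc l) i) / h (Suc l) i) \<longlonglongrightarrow> 0"
      proof (rule tendsto_0_le[OF gap always_eventually])
        show "\<forall>l. norm ((h l j - h (Suc l) i) / h (Suc l) i) \<le> norm (h l j - h (Suc l) i) * (1 / m)"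
          using m(1) m(2)[OF ij(1)] h_pos by (auto intro!: divide_left_mono simp: abs_of_pos)
      qed
      then have "(\<lambda>l. ?P i j * (1 + (h l j - h (Suc l) i) / h (Suc l) i)) \<longlonglongrightarrow> ?P i j * (1 + 0)"
        by (intro tendsto_intros)
      moreover have "1 + (h l j - h (Suc l) i) / h (Suc l) i = h l j / h (Suc l) i" for l
        using h_pos[of "Suc l"] by (simp add: diff_divide_distrib)
      ultimately show ?thesis
        by simp
    qed simp
    then have "(\<lambda>l. grw_mat (Suc l) M $$ (i, j)) \<longlonglongrightarrow> ?P i j"
      by (simp add: grw ij)
    then show ?thesis
      \<comment> \<open>The shift discards order 0, where \<open>l - 1\<close> is truncated.\<close>
      by (rule LIMSEQ_imp_Suc)
  qed
  have merw: "merw_mat M $$ (i, j) = ?P i j" if "i < N" "j < N" for i j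
    using that dim limI[OF limit[OF that]] by (simp add: merw_mat_def)
  have merw_dim: "dim_row (merw_mat M) = N" "dim_col (merw_mat M) = N"
    by (simp_all add: merw_mat_def dim)

  have "?P i j \<le> 1" if "i < N" "j < N" for i j
    unfolding P_row[OF that(1), symmetric] using that P_nonneg
    by (intro member_le_sum[where f = "?P i"]) auto
  then have stochastic: "stochastic_on M (merw_mat M)"
    unfolding stochastic_on_def dim using merw merw_dim P_nonneg P_row by auto

  \<comment> \<open>Uniqueness of the stationary density\<close>
  have unique: "stationary_density (merw_mat M) p \<longleftrightarrow> p = vec N ?pi" for p
  proof -
    have stat_merw: "(\<Sum>i<N. q $ i * merw_mat M $$ (i, j)) = (\<Sum>i<N. q $ i * ?P i j)" if "j < N" for q j
      using that by (intro sum.cong) (auto simp: merw)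
    show ?thesis
    proof
      assume p: "stationary_density (merw_mat M) p"
      then have p': "p \<in> carrier_vec N" "(\<Sum>i<N. p $ i) = 1"
        by (auto simp: stationary_density_def merw_dim)
      have "(\<Sum>i<N. p $ i / \<psi> $ i * M $$ (i, j)) = lam * (p $ j / \<psi> $ j)" if "j < N" for j
        using p that stat_iff[OF that, of "\<lambda>i. p $ i"]
        by (simp add: stationary_density_def merw_dim stat_merw)
      with left_eigenfunction_unique[OF M left_sum pos(2), of "\<lambda>i. p $ i / \<psi> $ i"]
      obtain c where c': "\<And>i. i < N \<Longrightarrow> p $ i / \<psi> $ i = c * \<phi> $ i"
        by auto
      have c: "p $ i = c * ?pi i" if "i < N" for i
        using c'[OF that] pos(1)[OF that] by (simp add: divide_eq_eq mult.assoc)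
      \<comment> \<open>Both densities have total mass 1, which forces \<open>c = 1\<close>.\<close>
      then have "c * (\<Sum>i<N. ?pi i) = 1"
        using p'(2) by (simp add: sum_distrib_left)
      with norm c p'(1) show "p = vec N ?pi"
        by (intro eq_vecI) auto
    next
      assume "p = vec N ?pi"
      then show "stationary_density (merw_mat M) p"
        using stat_merw[of _ p] P_stat norm pos
        by (auto simp: stationary_density_def merw_dim intro!: less_imp_le)
    qed
  qed

  \<comment> \<open>The normalization of \<open>perron_data\<close> fixes only the product of the
    scales of \<open>\<phi>\<close> and \<open>\<psi>\<close>. Hence the two agree only after
    rescaling, or when \<open>\<psi>\<close> has Euclidean norm 1.\<close>
  have symmetric: "(\<exists>c>0. perron_data M lam (c \<cdot>\<^sub>v \<psi>) (c \<cdot>\<^sub>v \<psi>) \<and>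
         vec N ?pi = vec N (\<lambda>i. ((c \<cdot>\<^sub>v \<psi>) $ i)\<^sup>2)) \<and>
       ((\<Sum>i<N. (\<psi> $ i)\<^sup>2) = 1 \<longrightarrow> \<phi> = \<psi> \<and> vec N ?pi = vec N (\<lambda>i. (\<psi> $ i)\<^sup>2))"
    if sym: "transpose_mat M = M"
  proof -
    have "(\<Sum>i<N. \<psi> $ i * M $$ (i, j)) = lam * \<psi> $ j" if "j < N" for j
      using left_eigenvector_sum[OF M(1), of \<psi>] right sym that by simp
    with left_eigenfunction_unique[OF M left_sum pos(2), of "\<lambda>i. \<psi> $ i"]
    obtain d where d: "\<And>i. i < N \<Longrightarrow> \<psi> $ i = d * \<phi> $ i"
      by auto
    have "0 < d"
      using d[of 0] pos[of 0] \<open>N \<noteq> 0\<close> by (simp add: zero_less_mult_iff)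
    \<comment> \<open>From \<open>\<psi> = d \<phi>\<close>, the square of
      \<open>c * \<psi> $ i\<close> is \<open>c\<^sup>2 * d * ?pi i\<close>, so
      \<open>c\<^sup>2 * d = 1\<close> is the required scaling.\<close>
    define c where "c = 1 / sqrt d"
    have c: "0 < c" "c\<^sup>2 * d = 1"
      using \<open>0 < d\<close> by (auto simp: c_def power_divide)
    have sq: "((c \<cdot>\<^sub>v \<psi>) $ i)\<^sup>2 = ?pi i" if "i < N" for i
    proof -
      have "((c \<cdot>\<^sub>v \<psi>) $ i)\<^sup>2 = (c\<^sup>2 * d) * ?pi i"
        using that carrier d[OF that] by (simp add: power2_eq_square)
      then show ?thesis
        by (simp add: c)
    qed
    have "perron_data M lam (c \<cdot>\<^sub>v \<psi>) (c \<cdot>\<^sub>v \<psi>)"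
      unfolding perron_data_def
      using dom eigenvector_smult[OF M(1) right, of c] c(1) pos' sym norm sq dim
      by (auto simp: positive_vector_def power2_eq_square)
    moreover have "vec N ?pi = vec N (\<lambda>i. ((c \<cdot>\<^sub>v \<psi>) $ i)\<^sup>2)"
      using sq by (intro eq_vecI) auto
    moreover have "\<phi> = \<psi>" if "(\<Sum>i<N. (\<psi> $ i)\<^sup>2) = 1"
    proof -
      have "(\<Sum>i<N. (\<psi> $ i)\<^sup>2) = d * (\<Sum>i<N. ?pi i)"
        unfolding sum_distrib_left by (intro sum.cong) (auto simp: d power2_eq_square)
      with that norm have "d = 1"
        by simp
      with d carrier show ?thesis
        by (intro eq_vecI) auto
    qed
    ultimately show ?thesis
      using c(1) by (auto simp: power2_eq_square)
  qed

  show ?thesis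
    using limit merw stochastic unique symmetric by (auto simp: convergent_def)
qed

end
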